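(* Suppose that $F : \mathsf C \to \mathsf D$ is a separable functor which preserves monomorphisms. Let $M$ be an object of $\mathsf C$ such that $F(M)$ is subobject semisimple in $\mathsf D$. Then $M$ is subobject semisimple in $\mathsf C$.
   Context: Functors are covariant. A functor $F:\mathsf C\to\mathsf D$ is separable if for all objects $M,N$ of $\mathsf C$ there is a function $R_{M,N}:\mathrm{Hom}_{\mathsf D}(F(M),F(N))\to\mathrm{Hom}_{\mathsf C}(M,N)$ such that (SF1) $R_{M,N}(F(h))=h$ for all $h:M\to N$ in $\mathsf C$; and (SF2) for all $h:M\to M'$, $g:N\to N'$ in $\mathsf C$ and $h':F(M)\to F(N)$, $g':F(M')\to F(N')$ in $\mathsf D$, if $F(g)h'=g'F(h)$ then $g\,R_{M,N}(h')=R_{M',N'}(g')\,h$. An object $M$ of a category is subobject semisimple if every monomorphism $m:P\to M$ has a retraction, i.e. a morphism $r:M\to P$ with $rm=\mathrm{id}_P$. *)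

theory Defs
  imports "HOL-Library.FuncSet"
begin

record ('o, 'm) cat =
  Obj :: "'o set"
  Arr :: "'m set"
  Dom :: "'m \<Rightarrow> 'o"
  Cod :: "'m \<Rightarrow> 'o"
  Ide :: "'o \<Rightarrow> 'm"
  Comp :: "'m \<Rightarrow> 'm \<Rightarrow> 'm"  (infixl "\<cdot>\<index>" 70)

text \<open>Composition is written in applicative order: \<open>g \<cdot>\<^bsub>C\<^esub> f\<close> is \<open>g\<close> after \<open>f\<close>, and is
  unspecified unless \<open>Cod C f = Dom C g\<close>.\<close>

definition Hom :: "('o, 'm) cat \<Rightarrow> 'o \<Rightarrow> 'o \<Rightarrow> 'm set" where
  "Hom C M N = {f \<in> Arr C. Dom C f = M \<and> Cod C f = N}"

locale category =
  fixes C :: "('o, 'm) cat" (structure)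
  assumes Dom_in_Obj: "f \<in> Arr C \<Longrightarrow> Dom C f \<in> Obj C"
    and Cod_in_Obj: "f \<in> Arr C \<Longrightarrow> Cod C f \<in> Obj C"
    and Ide_in_Hom: "M \<in> Obj C \<Longrightarrow> Ide C M \<in> Hom C M M"
    and Comp_in_Hom: "f \<in> Hom C M N \<Longrightarrow> g \<in> Hom C N P \<Longrightarrow> g \<cdot> f \<in> Hom C M P"
    and Comp_Ide: "f \<in> Hom C M N \<Longrightarrow> f \<cdot> Ide C M = f"
    and Ide_Comp: "f \<in> Hom C M N \<Longrightarrow> Ide C N \<cdot> f = f"
    and Comp_assoc: "f \<in> Hom C M N \<Longrightarrow> g \<in> Hom C N P \<Longrightarrow> h \<in> Hom C P Q \<Longrightarrow>
      h \<cdot> (g \<cdot> f) = (h \<cdot> g) \<cdot> f"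

record ('o, 'm, 'p, 'n) fun_data =
  omap :: "'o \<Rightarrow> 'p"
  amap :: "'m \<Rightarrow> 'n"

locale cat_functor = C: category C + D: category D
  for C :: "('o, 'm) cat" and D :: "('p, 'n) cat" +
  fixes F :: "('o, 'm, 'p, 'n) fun_data"
  assumes omap_in_Obj: "M \<in> Obj C \<Longrightarrow> omap F M \<in> Obj D"
    and amap_in_Hom: "f \<in> Hom C M N \<Longrightarrow> amap F f \<in> Hom D (omap F M) (omap F N)"
    and amap_Ide: "M \<in> Obj C \<Longrightarrow> amap F (Ide C M) = Ide D (omap F M)"
    and amap_Comp: "f \<in> Hom C M N \<Longrightarrow> g \<in> Hom C N P \<Longrightarrow>
      amap F (g \<cdot>\<^bsub>C\<^esub> f) = amap F g \<cdot>\<^bsub>D\<^esub> amap F f"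

locale separable_functor = cat_functor C D F
  for C :: "('o, 'm) cat" and D :: "('p, 'n) cat" and F :: "('o, 'm, 'p, 'n) fun_data" +
  assumes separable: "\<exists>R :: 'o \<Rightarrow> 'o \<Rightarrow> 'n \<Rightarrow> 'm.
    (\<forall>M \<in> Obj C. \<forall>N \<in> Obj C. R M N \<in> Hom D (omap F M) (omap F N) \<rightarrow> Hom C M N) \<and>
    (\<forall>M \<in> Obj C. \<forall>N \<in> Obj C. \<forall>h \<in> Hom C M N. R M N (amap F h) = h) \<and>
    (\<forall>M \<in> Obj C. \<forall>M' \<in> Obj C. \<forall>N \<in> Obj C. \<forall>N' \<in> Obj C.
      \<forall>h \<in> Hom C M M'. \<forall>g \<in> Hom C N N'.
      \<forall>h' \<in> Hom D (omap F M) (omap F N). \<forall>g' \<in> Hom D (omap F M') (omap F N').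
        amap F g \<cdot>\<^bsub>D\<^esub> h' = g' \<cdot>\<^bsub>D\<^esub> amap F h \<longrightarrow> g \<cdot>\<^bsub>C\<^esub> R M N h' = R M' N' g' \<cdot>\<^bsub>C\<^esub> h)"

definition monomorphism :: "('o, 'm) cat \<Rightarrow> 'm \<Rightarrow> bool" where
  "monomorphism C m \<longleftrightarrow> m \<in> Arr C \<and>
    (\<forall>Q \<in> Obj C. \<forall>f \<in> Hom C Q (Dom C m). \<forall>g \<in> Hom C Q (Dom C m).
      m \<cdot>\<^bsub>C\<^esub> f = m \<cdot>\<^bsub>C\<^esub> g \<longrightarrow> f = g)"

definition preserves_monomorphisms ::
  "('o, 'm) cat \<Rightarrow> ('p, 'n) cat \<Rightarrow> ('o, 'm, 'p, 'n) fun_data \<Rightarrow> bool" where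
  "preserves_monomorphisms C D F \<longleftrightarrow> (\<forall>m. monomorphism C m \<longrightarrow> monomorphism D (amap F m))"

definition subobject_semisimple :: "('o, 'm) cat \<Rightarrow> 'o \<Rightarrow> bool" where
  "subobject_semisimple C M \<longleftrightarrow>
    (\<forall>P \<in> Obj C. \<forall>m \<in> Hom C P M. monomorphism C m \<longrightarrow>
      (\<exists>r \<in> Hom C M P. r \<cdot>\<^bsub>C\<^esub> m = Ide C P))"

end

theory Submission
  imports Defs
begin

text \<open>A separable functor reflects split monomorphisms: if \<open>r'\<close> is a retraction of \<open>F(m)\<close>, then
  \<open>R(r')\<close> is a retraction of \<open>m\<close>, because (SF2) lets \<open>m\<close> be moved across \<open>R\<close> and (SF1) makes \<open>R\<close>
  send the identity to the identity. A monomorphism into \<open>M\<close> is mapped to a monomorphism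
  into \<open>F(M)\<close>, which splits by semisimplicity; so it already splits in the source category.\<close>

text \<open>The identity \<open>r' F(m) = id\<close> says that the square with top \<open>id\<close>, left \<open>F(m)\<close>, right
  \<open>F(id)\<close> and bottom \<open>r'\<close> commutes; naturality of \<open>R\<close> transports this square to
  \<open>R(r') m = R(id) = id\<close>.\<close>

lemma (in separable_functor) reflects_split_mono:
  assumes m: "m \<in> Hom C P M"
    and r': "r' \<in> Hom D (omap F M) (omap F P)"
    and split: "r' \<cdot>\<^bsub>D\<^esub> amap F m = Ide D (omap F P)"
  shows "\<exists>r \<in> Hom C M P. r \<cdot>\<^bsub>C\<^esub> m = Ide C P"
proof -
  obtain R :: "'o \<Rightarrow> 'o \<Rightarrow> 'n \<Rightarrow> 'm" where
    R_in_Hom: "\<forall>M \<in> Obj C. \<forall>N \<in> Obj C. R M N \<in> Hom D (omap F M) (omap F N) \<rightarrow> Hom C M N"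
    and SF1: "\<forall>M \<in> Obj C. \<forall>N \<in> Obj C. \<forall>h \<in> Hom C M N. R M N (amap F h) = h"
    and SF2: "\<forall>M \<in> Obj C. \<forall>M' \<in> Obj C. \<forall>N \<in> Obj C. \<forall>N' \<in> Obj C.
      \<forall>h \<in> Hom C M M'. \<forall>g \<in> Hom C N N'.
      \<forall>h' \<in> Hom D (omap F M) (omap F N). \<forall>g' \<in> Hom D (omap F M') (omap F N').
        amap F g \<cdot>\<^bsub>D\<^esub> h' = g' \<cdot>\<^bsub>D\<^esub> amap F h \<longrightarrow> g \<cdot>\<^bsub>C\<^esub> R M N h' = R M' N' g' \<cdot>\<^bsub>C\<^esub> h"
    using separable by (elim exE conjE)
  have P: "P \<in> Obj C" and M: "M \<in> Obj C"
    using m C.Dom_in_Obj C.Cod_in_Obj by (auto simp: Hom_def)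
  have id_P: "Ide C P \<in> Hom C P P" and id_FP: "Ide D (omap F P) \<in> Hom D (omap F P) (omap F P)"
    using P by (simp_all add: C.Ide_in_Hom D.Ide_in_Hom omap_in_Obj)
  have R_id: "R P P (Ide D (omap F P)) = Ide C P"
    using SF1 P id_P by (metis amap_Ide)
  have "amap F (Ide C P) \<cdot>\<^bsub>D\<^esub> Ide D (omap F P) = r' \<cdot>\<^bsub>D\<^esub> amap F m"
    using D.Comp_Ide[OF id_FP] by (simp add: amap_Ide P split)
  then have "Ide C P \<cdot>\<^bsub>C\<^esub> R P P (Ide D (omap F P)) = R M P r' \<cdot>\<^bsub>C\<^esub> m"
    using SF2 P M m id_P id_FP r' by blast
  then have "R M P r' \<cdot>\<^bsub>C\<^esub> m = Ide C P"
    using C.Comp_Ide[OF id_P] by (simp add: R_id)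
  then show ?thesis
    using R_in_Hom M P r' by blast
qed

theorem proposition17:
  fixes C :: "('o, 'm) cat" and D :: "('p, 'n) cat"
    and F :: "('o, 'm, 'p, 'n) fun_data" and M :: 'o
  assumes "separable_functor C D F"
    and "preserves_monomorphisms C D F"
    and "M \<in> Obj C"
    and "subobject_semisimple D (omap F M)"
  shows "subobject_semisimple C M"
proof -
  interpret separable_functor C D F by fact
  show ?thesis
    unfolding subobject_semisimple_def
  proof (intro ballI impI)
    fix P m
    assume P: "P \<in> Obj C" and m: "m \<in> Hom C P M" and mono: "monomorphism C m"
    have "monomorphism D (amap F m)"
      using assms(2) mono by (simp add: preserves_monomorphisms_def)
    then obtain r' where "r' \<in> Hom D (omap F M) (omap F P)"
      and "r' \<cdot>\<^bsub>D\<^esub> amap F m = Ide D (omap F P)"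
      using assms(4) omap_in_Obj[OF P] amap_in_Hom[OF m]
      by (auto simp: subobject_semisimple_def)
    then show "\<exists>r \<in> Hom C M P. r \<cdot>\<^bsub>C\<^esub> m = Ide C P"
      by (rule reflects_split_mono[OF m])
  qed
qed

end
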